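(* Let $N\ge 1$, let $\sigma\in\mathcal S_N$, let $d_1,\dots,d_N\in\mathbb C$, and let $A=D+M_\sigma$ with $D=\mathrm{diag}(d_1,\dots,d_N)$ and $M_\sigma$ the permutation matrix of $\sigma$. Let $C_1,\dots,C_{K(\sigma)}$ be the cycles of $\sigma$, of lengths $N_1,\dots,N_{K(\sigma)}$, and let $A_i=D_i+U_{N_i}$ be the associated blocks. Then: (1) $A$ is invertible if and only if, for every $1\le i\le K(\sigma)$, $\prod_{\ell\in C_i}d_\ell\neq(-1)^{N_i}$. (2) $s_{\min}(A)=\min_{1\le i\le K(\sigma)}s_{\min}(A_i)$.
   Context: $\mathcal S_N$ is the symmetric group on $\{1,\dots,N\}$. $M_\sigma$ is the $N\times N$ matrix with $M_\sigma(i,j)=1$ if $\sigma(i)=j$ and $0$ otherwise. $K(\sigma)$ is the number of cycles of $\sigma$ (fixed points count as cycles of length 1), ordered so that $N_1\ge\dots\ge N_{K(\sigma)}$. Each cycle is written $C_i=(n_i,\sigma(n_i),\dots,\sigma^{N_i-1}(n_i))$ for a chosen starting element $n_i$, and $D_i=\mathrm{diag}(d_{n_i},d_{\sigma(n_i)},\dots,d_{\sigma^{N_i-1}(n_i)})$. For $n\ge1$, $U_n$ is the $n\times n$ cyclic shift matrix: $(U_n)_{k,k+1}=1$ for $1\le k\le n-1$, $(U_n)_{n,1}=1$, all other entries $0$ (so $U_1=(1)$). $s_{\min}$ denotes the smallest singular value. *)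

theory Defs
  imports
    "Jordan_Normal_Form.Schur_Decomposition"
    "HOL-Combinatorics.Cycles"
begin

text \<open>Indices are 0-based, as in the matrix library: $\mathcal S_N$ acts on \<open>{0..<N}\<close> and the
  cycles are numbered \<open>0, ..., K - 1\<close>.\<close>

definition permutation_mat :: "nat \<Rightarrow> (nat \<Rightarrow> nat) \<Rightarrow> complex mat" where
  "permutation_mat N \<sigma> = mat N N (\<lambda>(i, j). if \<sigma> i = j then 1 else 0)"

definition cyclic_shift_mat :: "nat \<Rightarrow> complex mat" where
  "cyclic_shift_mat n =
     mat n n (\<lambda>(k, l). if l = Suc k \<or> (Suc k = n \<and> l = 0) then 1 else 0)"

definition singular_values :: "complex mat \<Rightarrow> real set" where
  "singular_values A = {s. 0 \<le> s \<and> eigenvalue (mat_adjoint A * A) (complex_of_real (s\<^sup>2))}"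

definition s_min :: "complex mat \<Rightarrow> real" where
  "s_min A = Min (singular_values A)"

text \<open>The library's \<open>support \<sigma> x\<close> is the list \<open>[x, \<sigma> x, \<sigma> (\<sigma> x), ...]\<close> that runs once through the
  cycle of \<open>\<sigma>\<close> containing \<open>x\<close>; it is \<open>[x]\<close> if \<open>x\<close> is a fixed point. As a set, a cycle does not depend
  on its starting element.\<close>

definition cycle_sets :: "nat \<Rightarrow> (nat \<Rightarrow> nat) \<Rightarrow> nat set set" where
  "cycle_sets N \<sigma> = (\<lambda>x. set (support \<sigma> x)) ` {0..<N}"

definition num_cycles :: "nat \<Rightarrow> (nat \<Rightarrow> nat) \<Rightarrow> nat" where
  "num_cycles N \<sigma> = card (cycle_sets N \<sigma>)"

text \<open>\<open>n i\<close> is the chosen starting element of the cycle number \<open>i\<close>; every cycle is listed exactly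
  once, in order of nonincreasing length.\<close>

definition cycle_starts :: "nat \<Rightarrow> (nat \<Rightarrow> nat) \<Rightarrow> (nat \<Rightarrow> nat) \<Rightarrow> bool" where
  "cycle_starts N \<sigma> n \<longleftrightarrow>
     n ` {0..<num_cycles N \<sigma>} \<subseteq> {0..<N} \<and>
     bij_betw (\<lambda>i. set (support \<sigma> (n i))) {0..<num_cycles N \<sigma>} (cycle_sets N \<sigma>) \<and>
     (\<forall>i j. i \<le> j \<longrightarrow> j < num_cycles N \<sigma> \<longrightarrow>
        length (support \<sigma> (n j)) \<le> length (support \<sigma> (n i)))"

text \<open>The block \<open>A\<^sub>i = D\<^sub>i + U\<^bsub>N\<^sub>i\<^esub>\<close> of a cycle given as a list.\<close>

definition cycle_block :: "(nat \<Rightarrow> complex) \<Rightarrow> nat list \<Rightarrow> complex mat" where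
  "cycle_block d c = mat_diag (length c) (\<lambda>k. d (c ! k)) + cyclic_shift_mat (length c)"

end

theory Submission
  imports Defs "Jordan_Normal_Form.Spectral_Radius"
begin

text \<open>
  Entry \<open>(i, j)\<close> of \<open>A = D + M\<^sub>\<sigma>\<close> vanishes unless \<open>j = i\<close> or \<open>j = \<sigma> i\<close>, so \<open>A\<close> never
  connects an index inside a cycle with an index outside it: the coordinates of a cycle span a
  reducing subspace, on which \<open>A\<close> acts, in the order of the cycle, as its block. Instead of
  conjugating \<open>A\<close> by a permutation matrix to make it block diagonal, the proof works with this
  zero pattern. For a matrix that is reduced by each of a family of index lists covering all
  indices, an eigenvector can be cut down to a list on which it is nonzero, and an eigenvector of a
  block can be extended by zero; hence the eigenvalues of the matrix are those of its blocks
  together (\<open>eigenvalue_iff_block\<close>).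

  Both parts of the theorem are instances of this. For (1), the matrix is \<open>A\<close> and the eigenvalue
  is \<open>0\<close>; the kernel of one block is governed by the recurrence \<open>v\<^bsub>k+1\<^esub> = - d\<^sub>k v\<^sub>k\<close>, which closes
  up around the cycle for a nonzero \<open>v\<close> exactly if the product of the \<open>- d\<^sub>k\<close> is \<open>1\<close>
  (\<open>eigenvalue_0_cycle_block\<close>). For (2), the matrix is \<open>A\<^sup>* A\<close>, which inherits the zero pattern and
  whose blocks are the matrices \<open>A\<^sub>i\<^sup>* A\<^sub>i\<close>. So the set of singular values of \<open>A\<close> is the union of
  those of the blocks. These sets are finite and nonempty, and the minimum of their union is the
  minimum of their minima.
\<close>

section \<open>Matrices reduced by sets of coordinates\<close>

definition block_of :: "'a mat \<Rightarrow> nat list \<Rightarrow> 'a mat" where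
  "block_of M c = mat (length c) (length c) (\<lambda>(k, l). M $$ (c ! k, c ! l))"

text \<open>The condition says that both the span of the coordinates in \<open>c\<close> and the span of the other
  coordinates are invariant under \<open>M\<close>.\<close>

definition reduced_by :: "'a :: zero mat \<Rightarrow> nat list \<Rightarrow> bool" where
  "reduced_by M c \<longleftrightarrow>
     (\<forall>i < dim_row M. \<forall>j < dim_col M. M $$ (i, j) \<noteq> 0 \<longrightarrow> (i \<in> set c \<longleftrightarrow> j \<in> set c))"

lemma block_of_carrier [simp]: "block_of M c \<in> carrier_mat (length c) (length c)"
  by (simp add: block_of_def)

lemma sum_nth_distinct:
  fixes f :: "nat \<Rightarrow> 'a :: comm_monoid_add"
  assumes "distinct c"
  shows "(\<Sum>k < length c. f (c ! k)) = (\<Sum>i \<in> set c. f i)"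
  using sum.reindex_bij_betw[OF bij_betw_nth[OF assms refl refl], of f] .

text \<open>Eigenvectors are handled as plain functions on indices: a function restricts to a list of
  indices without any change of type or dimension.\<close>

lemma eigenvalue_iff_fun:
  assumes "M \<in> carrier_mat n n"
  shows "eigenvalue M \<mu> \<longleftrightarrow>
    (\<exists>v. (\<exists>i < n. v i \<noteq> 0) \<and> (\<forall>i < n. (\<Sum>j < n. M $$ (i, j) * v j) = \<mu> * v i))"
proof
  assume "eigenvalue M \<mu>"
  then obtain w where w: "w \<in> carrier_vec n" "w \<noteq> 0\<^sub>v n" "M *\<^sub>v w = \<mu> \<cdot>\<^sub>v w"
    using assms unfolding eigenvalue_def eigenvector_def by auto
  have "\<exists>i < n. w $ i \<noteq> 0"
    using w(1,2) by (metis carrier_vecD eq_vecI index_zero_vec(1) index_zero_vec(2))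
  moreover have "(\<Sum>j < n. M $$ (i, j) * w $ j) = \<mu> * w $ i" if "i < n" for i
  proof -
    have "(M *\<^sub>v w) $ i = (\<mu> \<cdot>\<^sub>v w) $ i" using w(3) by simp
    then show ?thesis
      using that assms w(1) by (simp add: scalar_prod_def lessThan_atLeast0)
  qed
  ultimately show "\<exists>v. (\<exists>i < n. v i \<noteq> 0) \<and> (\<forall>i < n. (\<Sum>j < n. M $$ (i, j) * v j) = \<mu> * v i)"
    by blast
next
  assume "\<exists>v. (\<exists>i < n. v i \<noteq> 0) \<and> (\<forall>i < n. (\<Sum>j < n. M $$ (i, j) * v j) = \<mu> * v i)"
  then obtain v where v: "\<exists>i < n. v i \<noteq> 0"
      "\<And>i. i < n \<Longrightarrow> (\<Sum>j < n. M $$ (i, j) * v j) = \<mu> * v i"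
    by blast
  have "vec n v \<noteq> 0\<^sub>v n"
    using v(1) by (metis index_vec index_zero_vec(1))
  moreover have "M *\<^sub>v vec n v = \<mu> \<cdot>\<^sub>v vec n v"
    using assms v(2) by (intro eq_vecI) (auto simp: scalar_prod_def lessThan_atLeast0)
  ultimately show "eigenvalue M \<mu>"
    using assms unfolding eigenvalue_def eigenvector_def
    by (intro exI[of _ "vec n v"]) auto
qed

lemma eigenvalue_block_of_iff_fun:
  fixes M :: "'a :: comm_ring_1 mat"
  assumes "distinct c"
  shows "eigenvalue (block_of M c) \<mu> \<longleftrightarrow>
    (\<exists>v. (\<exists>i \<in> set c. v i \<noteq> 0) \<and>
         (\<forall>i \<in> set c. (\<Sum>j \<in> set c. M $$ (i, j) * v j) = \<mu> * v i))"
    (is "_ \<longleftrightarrow> ?R")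
proof -
  let ?P = "\<lambda>u. (\<exists>k < length c. u k \<noteq> 0) \<and>
    (\<forall>k < length c. (\<Sum>l < length c. M $$ (c ! k, c ! l) * u l) = \<mu> * u k)"
  have "eigenvalue (block_of M c) \<mu> \<longleftrightarrow> (\<exists>u. ?P u)"
    by (subst eigenvalue_iff_fun[OF block_of_carrier]) (simp add: block_of_def)
  \<comment> \<open>Functions on positions and functions on the entries of \<open>c\<close> are the same thing,
    because no entry is repeated.\<close>
  also have "(\<exists>u. ?P u) \<longleftrightarrow> (\<exists>v. ?P (\<lambda>k. v (c ! k)))"
  proof
    assume "\<exists>u. ?P u"
    then obtain u where u: "?P u" by blast
    define v where "v i = u (the_inv_into {..<length c} ((!) c) i)" for i
    have "v (c ! k) = u k" if "k < length c" for k
      using that assms by (simp add: v_def the_inv_into_f_f inj_on_nth)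
    then have "?P (\<lambda>k. v (c ! k))" using u by (simp cong: conj_cong)
    then show "\<exists>v. ?P (\<lambda>k. v (c ! k))" by (rule exI[of _ v])
  next
    assume "\<exists>v. ?P (\<lambda>k. v (c ! k))"
    then obtain v where "?P (\<lambda>k. v (c ! k))" by (rule exE)
    then show "\<exists>u. ?P u" by (rule exI[of ?P])
  qed
  also have "\<dots> \<longleftrightarrow> ?R"
  proof -
    have "(\<Sum>l < length c. M $$ (c ! k, c ! l) * v (c ! l)) = (\<Sum>j \<in> set c. M $$ (c ! k, j) * v j)"
      for k and v :: "nat \<Rightarrow> 'a"
      by (rule sum_nth_distinct[OF assms, of "\<lambda>j. M $$ (c ! k, j) * v j"])
    then show ?thesis by (simp add: Bex_set Ball_set list_ex_length list_all_length)
  qed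
  finally show ?thesis .
qed

text \<open>An eigenvector of \<open>M\<close> has a nonzero coordinate in some list, and its restriction to that list
  is an eigenvector of the block. Conversely, the extension by zero of an eigenvector of a block is
  an eigenvector of \<open>M\<close>. Each direction uses one of the two invariant subspaces.\<close>

lemma eigenvalue_iff_block:
  fixes M :: "'a :: comm_ring_1 mat"
  assumes M: "M \<in> carrier_mat n n"
    and dist: "\<And>c. c \<in> F \<Longrightarrow> distinct c"
    and cover: "(\<Union>c \<in> F. set c) = {..<n}"
    and red: "\<And>c. c \<in> F \<Longrightarrow> reduced_by M c"
  shows "eigenvalue M \<mu> \<longleftrightarrow> (\<exists>c \<in> F. eigenvalue (block_of M c) \<mu>)"
proof
  assume "eigenvalue M \<mu>"
  then obtain v i where v: "i < n" "v i \<noteq> 0"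
      "\<And>i. i < n \<Longrightarrow> (\<Sum>j < n. M $$ (i, j) * v j) = \<mu> * v i"
    unfolding eigenvalue_iff_fun[OF M] by blast
  from v(1) cover obtain c where c: "c \<in> F" "i \<in> set c" by blast
  then have sub: "set c \<subseteq> {..<n}" using cover by blast
  have "(\<Sum>j \<in> set c. M $$ (i, j) * v j) = \<mu> * v i" if "i \<in> set c" for i
  proof -
    have "(\<Sum>j \<in> set c. M $$ (i, j) * v j) = (\<Sum>j < n. M $$ (i, j) * v j)"
    proof (intro sum.mono_neutral_left ballI)
      fix j assume "j \<in> {..<n} - set c"
      then have "M $$ (i, j) = 0"
        using red[OF c(1)] that sub M unfolding reduced_by_def by auto
      then show "M $$ (i, j) * v j = 0" by simp
    qed (use sub in auto)
    then show ?thesis using v(3) that sub by auto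
  qed
  then show "\<exists>c \<in> F. eigenvalue (block_of M c) \<mu>"
    using c v(2) eigenvalue_block_of_iff_fun[OF dist[OF c(1)], of M \<mu>] by blast
next
  assume "\<exists>c \<in> F. eigenvalue (block_of M c) \<mu>"
  then obtain c where c: "c \<in> F" "eigenvalue (block_of M c) \<mu>" by blast
  then have sub: "set c \<subseteq> {..<n}" using cover by blast
  from c(2) obtain v i where v: "i \<in> set c" "v i \<noteq> 0"
      "\<And>i. i \<in> set c \<Longrightarrow> (\<Sum>j \<in> set c. M $$ (i, j) * v j) = \<mu> * v i"
    unfolding eigenvalue_block_of_iff_fun[OF dist[OF c(1)]] by blast
  define w where "w j = (if j \<in> set c then v j else 0)" for j
  have "(\<Sum>j < n. M $$ (i, j) * w j) = \<mu> * w i" if i: "i < n" for i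
  proof -
    have "(\<Sum>j < n. M $$ (i, j) * w j) = (\<Sum>j \<in> set c. M $$ (i, j) * v j)"
      using sub by (intro sum.mono_neutral_cong_right) (auto simp: w_def)
    also have "\<dots> = \<mu> * w i"
    proof (cases "i \<in> set c")
      case True
      then show ?thesis using v(3) by (simp add: w_def)
    next
      case False
      then have "M $$ (i, j) = 0" if "j \<in> set c" for j
        using red[OF c(1)] that sub i M unfolding reduced_by_def by auto
      then show ?thesis using False by (simp add: w_def)
    qed
    finally show ?thesis .
  qed
  moreover have "i < n" "w i \<noteq> 0" using v(1,2) sub by (auto simp: w_def)
  ultimately show "eigenvalue M \<mu>" unfolding eigenvalue_iff_fun[OF M] by blast
qed

section \<open>Singular values\<close>

lemma adjoint_mult_carrier:
  "A \<in> carrier_mat n n \<Longrightarrow> mat_adjoint A * A \<in> carrier_mat n n"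
  by (auto simp: mat_adjoint_def)

lemma adjoint_mult_index:
  fixes A :: "complex mat"
  assumes "A \<in> carrier_mat n n" "i < n" "j < n"
  shows "(mat_adjoint A * A) $$ (i, j) = (\<Sum>r < n. cnj (A $$ (r, i)) * A $$ (r, j))"
  using assms
  by (simp add: mat_adjoint_def mat_of_rows_def scalar_prod_def lessThan_atLeast0 conjugate_complex_def)

lemma reduced_by_adjoint_mult:
  fixes A :: "complex mat"
  assumes A: "A \<in> carrier_mat n n" and red: "reduced_by A c"
  shows "reduced_by (mat_adjoint A * A) c"
proof -
  have "i \<in> set c \<longleftrightarrow> j \<in> set c"
    if ij: "i < n" "j < n" and nz: "(mat_adjoint A * A) $$ (i, j) \<noteq> 0" for i j
  proof -
    obtain r where "r < n" "cnj (A $$ (r, i)) * A $$ (r, j) \<noteq> 0"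
      using nz unfolding adjoint_mult_index[OF A ij]
      by (auto elim: sum.not_neutral_contains_not_neutral)
    then have "r < n" "A $$ (r, i) \<noteq> 0" "A $$ (r, j) \<noteq> 0" by auto
    then show ?thesis using red A ij unfolding reduced_by_def by auto
  qed
  then show ?thesis
    unfolding reduced_by_def carrier_matD[OF adjoint_mult_carrier[OF A]] by blast
qed

text \<open>Rows of \<open>A\<close> outside \<open>c\<close> are zero on \<open>c\<close>, so they do not contribute to the inner products of
  columns in \<open>c\<close>.\<close>

lemma block_of_adjoint_mult:
  fixes A :: "complex mat"
  assumes A: "A \<in> carrier_mat n n" and red: "reduced_by A c"
    and "distinct c" and sub: "set c \<subseteq> {..<n}"
  shows "block_of (mat_adjoint A * A) c = mat_adjoint (block_of A c) * block_of A c"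
    (is "?L = ?R")
proof (rule eq_matI)
  have R: "?R \<in> carrier_mat (length c) (length c)"
    by (rule adjoint_mult_carrier[OF block_of_carrier])
  then show "dim_row ?L = dim_row ?R" "dim_col ?L = dim_col ?R"
    using carrier_matD[OF R] by (simp_all add: carrier_matD[OF block_of_carrier])
  fix k l assume "k < dim_row ?R" "l < dim_col ?R"
  with R have kl: "k < length c" "l < length c" by auto
  then have ckl: "c ! k \<in> set c" "c ! l \<in> set c" by auto
  then have lt: "c ! k < n" "c ! l < n" using sub by auto
  have "?L $$ (k, l) = (\<Sum>r < n. cnj (A $$ (r, c ! k)) * A $$ (r, c ! l))"
    using kl adjoint_mult_index[OF A lt] by (simp add: block_of_def)
  also have "\<dots> = (\<Sum>r \<in> set c. cnj (A $$ (r, c ! k)) * A $$ (r, c ! l))"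
  proof (intro sum.mono_neutral_right ballI)
    fix r assume "r \<in> {..<n} - set c"
    then have "A $$ (r, c ! l) = 0"
      using red A ckl(2) lt(2) unfolding reduced_by_def by auto
    then show "cnj (A $$ (r, c ! k)) * A $$ (r, c ! l) = 0" by simp
  qed (use sub in auto)
  also have "\<dots> = (\<Sum>q < length c. cnj (A $$ (c ! q, c ! k)) * A $$ (c ! q, c ! l))"
    by (rule sum_nth_distinct[OF \<open>distinct c\<close>, symmetric])
  also have "\<dots> = ?R $$ (k, l)"
    using kl adjoint_mult_index[OF block_of_carrier kl, of A] by (simp add: block_of_def)
  finally show "?L $$ (k, l) = ?R $$ (k, l)" .
qed

lemma singular_values_Union_blocks:
  fixes A :: "complex mat"
  assumes A: "A \<in> carrier_mat n n"
    and dist: "\<And>c. c \<in> F \<Longrightarrow> distinct c"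
    and cover: "(\<Union>c \<in> F. set c) = {..<n}"
    and red: "\<And>c. c \<in> F \<Longrightarrow> reduced_by A c"
  shows "singular_values A = (\<Union>c \<in> F. singular_values (block_of A c))"
proof -
  have "block_of (mat_adjoint A * A) c = mat_adjoint (block_of A c) * block_of A c"
    if "c \<in> F" for c
    using that cover by (intro block_of_adjoint_mult[OF A red dist]) auto
  then have "eigenvalue (mat_adjoint A * A) \<mu> \<longleftrightarrow>
      (\<exists>c \<in> F. eigenvalue (mat_adjoint (block_of A c) * block_of A c) \<mu>)" for \<mu>
    using eigenvalue_iff_block[OF adjoint_mult_carrier[OF A] dist cover
        reduced_by_adjoint_mult[OF A red]]
    by simp
  then show ?thesis unfolding singular_values_def by auto
qed

text \<open>If \<open>A\<^sup>* A v = \<mu> v\<close>, pairing with \<open>v\<close> gives \<open>\<parallel>A v\<parallel>\<^sup>2 = \<mu> \<parallel>v\<parallel>\<^sup>2\<close>.\<close>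

lemma eigenvalue_adjoint_mult_nonneg:
  fixes A :: "complex mat"
  assumes A: "A \<in> carrier_mat n n" and ev: "eigenvalue (mat_adjoint A * A) \<mu>"
  shows "\<exists>x \<ge> 0. \<mu> = complex_of_real x"
proof -
  from ev obtain v i where v: "i < n" "v i \<noteq> 0"
      "\<And>i. i < n \<Longrightarrow> (\<Sum>j < n. (mat_adjoint A * A) $$ (i, j) * v j) = \<mu> * v i"
    unfolding eigenvalue_iff_fun[OF adjoint_mult_carrier[OF A]] by blast
  define Av where "Av r = (\<Sum>j < n. A $$ (r, j) * v j)" for r
  define a where "a = (\<Sum>r < n. (cmod (Av r))\<^sup>2)"
  define b where "b = (\<Sum>i < n. (cmod (v i))\<^sup>2)"
  have "complex_of_real a = (\<Sum>r < n. cnj (Av r) * Av r)"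
    unfolding a_def of_real_sum complex_norm_square by (simp add: mult.commute)
  also have "\<dots> = (\<Sum>r < n. \<Sum>i < n. \<Sum>j < n.
      cnj (v i) * (cnj (A $$ (r, i)) * A $$ (r, j) * v j))"
    unfolding Av_def cnj_sum sum_product by (intro sum.cong refl) simp
  also have "\<dots> = (\<Sum>i < n. \<Sum>j < n. \<Sum>r < n.
      cnj (v i) * (cnj (A $$ (r, i)) * A $$ (r, j) * v j))"
    by (rule trans[OF sum.swap], rule sum.cong[OF refl], rule sum.swap)
  also have "\<dots> = (\<Sum>i < n. cnj (v i) * (\<Sum>j < n. (mat_adjoint A * A) $$ (i, j) * v j))"
    by (intro sum.cong refl)
      (simp add: adjoint_mult_index[OF A] sum_distrib_left sum_distrib_right mult.assoc)
  also have "\<dots> = (\<Sum>i < n. \<mu> * (v i * cnj (v i)))"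
    by (intro sum.cong refl) (simp add: v(3))
  also have "\<dots> = \<mu> * complex_of_real b"
    unfolding b_def of_real_sum complex_norm_square by (simp add: sum_distrib_left)
  finally have ab: "complex_of_real a = \<mu> * complex_of_real b" .
  have "0 < (cmod (v i))\<^sup>2" using v(2) by simp
  also have "\<dots> \<le> b"
    unfolding b_def using v(1) by (intro member_le_sum) auto
  finally have "0 < b" .
  then have "\<mu> = complex_of_real (a / b)" using ab by (simp add: field_simps)
  moreover have "0 \<le> a / b" using \<open>0 < b\<close> unfolding a_def by (simp add: sum_nonneg)
  ultimately show ?thesis by blast
qed

lemma finite_singular_values:
  assumes "A \<in> carrier_mat n n"
  shows "finite (singular_values A)"
proof (rule finite_subset)
  show "singular_values A \<subseteq> (\<lambda>\<mu>. sqrt (Re \<mu>)) ` spectrum (mat_adjoint A * A)"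
    by (force simp: singular_values_def spectrum_def image_iff)
  show "finite ((\<lambda>\<mu>. sqrt (Re \<mu>)) ` spectrum (mat_adjoint A * A))"
    using card_finite_spectrum(1)[OF adjoint_mult_carrier[OF assms]] by simp
qed

text \<open>The minimum of an empty set has no specified value, so \<open>s_min\<close> is meaningful only because
  \<open>A\<^sup>* A\<close> has some complex eigenvalue, and this eigenvalue has a real square root.\<close>

lemma singular_values_nonempty:
  assumes A: "A \<in> carrier_mat n n" and "0 < n"
  shows "singular_values A \<noteq> {}"
proof -
  from spectrum_non_empty[OF adjoint_mult_carrier[OF A] \<open>0 < n\<close>]
  obtain \<mu> where \<mu>: "eigenvalue (mat_adjoint A * A) \<mu>" by (auto simp: spectrum_def)
  then obtain x where "0 \<le> x" "\<mu> = complex_of_real x"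
    using eigenvalue_adjoint_mult_nonneg[OF A] by blast
  with \<mu> have "sqrt x \<in> singular_values A"
    by (simp add: singular_values_def flip: of_real_power)
  then show ?thesis by blast
qed

lemma Min_UN:
  fixes S :: "'i \<Rightarrow> 'a :: linorder set"
  assumes "finite I" "I \<noteq> {}" "\<And>i. i \<in> I \<Longrightarrow> finite (S i)" "\<And>i. i \<in> I \<Longrightarrow> S i \<noteq> {}"
  shows "Min (\<Union>i \<in> I. S i) = (MIN i \<in> I. Min (S i))"
proof (rule Min_eqI)
  show "finite (\<Union>i \<in> I. S i)" using assms by blast
  show "(MIN i \<in> I. Min (S i)) \<le> x" if "x \<in> (\<Union>i \<in> I. S i)" for x
  proof -
    from that obtain i where i: "i \<in> I" "x \<in> S i" by blast
    then have "(MIN i \<in> I. Min (S i)) \<le> Min (S i)" using assms(1) by simp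
    also have "\<dots> \<le> x" using i assms(3) by simp
    finally show ?thesis .
  qed
  have "(MIN i \<in> I. Min (S i)) \<in> (\<lambda>i. Min (S i)) ` I"
    using assms(1,2) by (intro Min_in) auto
  then show "(MIN i \<in> I. Min (S i)) \<in> (\<Union>i \<in> I. S i)"
    using Min_in[OF assms(3,4)] by fastforce
qed

section \<open>Invertibility and the kernel of a block\<close>

lemma invertible_mat_iff_not_eigenvalue_0:
  fixes A :: "'a :: field mat"
  assumes A: "A \<in> carrier_mat n n"
  shows "invertible_mat A \<longleftrightarrow> \<not> eigenvalue A 0"
proof
  assume "invertible_mat A"
  then obtain B where B: "B * A = 1\<^sub>m (dim_row B)" "A * B = 1\<^sub>m (dim_row A)"
    unfolding invertible_mat_def inverts_mat_def by blast
  from arg_cong[OF B(1), of dim_col] arg_cong[OF B(2), of dim_col] A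
  have Bc: "B \<in> carrier_mat n n" by auto
  show "\<not> eigenvalue A 0"
  proof
    assume "eigenvalue A 0"
    then obtain v where v: "v \<in> carrier_vec n" "v \<noteq> 0\<^sub>v n" "A *\<^sub>v v = 0 \<cdot>\<^sub>v v"
      using A unfolding eigenvalue_def eigenvector_def by auto
    have "v = (B * A) *\<^sub>v v" using B(1) Bc v(1) by simp
    also have "\<dots> = B *\<^sub>v (A *\<^sub>v v)" using A Bc v(1) by simp
    also have "\<dots> = 0\<^sub>v n" using v(1,3) Bc by (auto simp: scalar_prod_def)
    finally show False using v(2) by simp
  qed
next
  assume "\<not> eigenvalue A 0"
  moreover have "0 \<cdot>\<^sub>v v = 0\<^sub>v n" if "v \<in> carrier_vec n" for v :: "'a vec"
    using that by auto
  ultimately have "det A \<noteq> 0"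
    using A unfolding det_0_iff_vec_prod_zero[OF A] eigenvalue_def eigenvector_def by fastforce
  from det_non_zero_imp_unit[OF A this]
  obtain B where "B \<in> carrier_mat n n" "B * A = 1\<^sub>m n" "A * B = 1\<^sub>m n"
    unfolding Units_def by (auto simp: ring_mat_def)
  then show "invertible_mat A"
    using A unfolding invertible_mat_def inverts_mat_def by auto
qed

lemma cycle_block_carrier [simp]: "cycle_block d c \<in> carrier_mat (length c) (length c)"
  by (auto simp: cycle_block_def cyclic_shift_mat_def mat_diag_def)

text \<open>Taken modulo the length, the successor of a position covers both the superdiagonal of the
  shift matrix and its corner entry; for length \<open>1\<close> it is the diagonal entry.\<close>

lemma cycle_block_index:
  assumes "k < length c" "l < length c"
  shows "cycle_block d c $$ (k, l) =
    (if l = k then d (c ! k) else 0) + (if l = Suc k mod length c then 1 else 0)"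
proof -
  have "(l = Suc k \<or> (Suc k = length c \<and> l = 0)) \<longleftrightarrow> l = Suc k mod length c"
    using assms by (cases "Suc k = length c") auto
  then show ?thesis
    using assms by (auto simp: cycle_block_def cyclic_shift_mat_def mat_diag_def)
qed

text \<open>A kernel vector satisfies \<open>v\<^bsub>k+1\<^esub> = - d\<^sub>k v\<^sub>k\<close>, so it is the multiple by \<open>v\<^sub>0\<close> of the partial
  products of the \<open>- d\<^sub>k\<close>; the last row requires that the full product leads back to \<open>v\<^sub>0\<close>.\<close>

lemma eigenvalue_0_cycle_block:
  assumes "distinct c" "c \<noteq> []"
  shows "eigenvalue (cycle_block d c) 0 \<longleftrightarrow> (\<Prod>l \<in> set c. d l) = (- 1) ^ length c"
proof -
  define m where "m = length c"
  have m: "0 < m" using assms(2) by (simp add: m_def)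
  define p where "p k = (\<Prod>q < k. - d (c ! q))" for k
  have p_Suc: "p (Suc k) = - d (c ! k) * p k" for k by (simp add: p_def)
  have row: "(\<Sum>l < m. cycle_block d c $$ (k, l) * v l) = d (c ! k) * v k + v (Suc k mod m)"
    if k: "k < m" for k and v :: "nat \<Rightarrow> complex"
  proof -
    have "(\<Sum>l < m. cycle_block d c $$ (k, l) * v l) =
        (\<Sum>l < m. (if l = k then d (c ! k) * v l else 0) + (if l = Suc k mod m then v l else 0))"
      using k by (intro sum.cong refl) (auto simp: cycle_block_index m_def distrib_right)
    then show ?thesis using k m by (simp add: sum.distrib sum.delta)
  qed
  have "p m = (- 1) ^ m * (\<Prod>q < m. d (c ! q))"
    by (simp add: p_def prod_uminus)
  also have "(\<Prod>q < m. d (c ! q)) = (\<Prod>l \<in> set c. d l)"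
    using prod.reindex_bij_betw[OF bij_betw_nth[OF assms(1) refl refl], of d] by (simp add: m_def)
  finally have pm: "p m = (- 1) ^ m * (\<Prod>l \<in> set c. d l)" .
  have "(- 1 :: complex) ^ m * (- 1) ^ m = 1"
    by (simp flip: power_mult_distrib)
  then have "p m = 1 \<longleftrightarrow> (\<Prod>l \<in> set c. d l) = (- 1) ^ m"
    unfolding pm by (metis mult.assoc mult.left_neutral mult.right_neutral)
  moreover have "eigenvalue (cycle_block d c) 0 \<longleftrightarrow>
      (\<exists>v. (\<exists>k < m. v k \<noteq> 0) \<and> (\<forall>k < m. d (c ! k) * v k + v (Suc k mod m) = 0))"
    unfolding m_def by (subst eigenvalue_iff_fun[OF cycle_block_carrier])
      (simp add: row[unfolded m_def])
  moreover have "\<dots> \<longleftrightarrow> p m = 1"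
  proof
    assume "p m = 1"
    have "d (c ! k) * p k + p (Suc k mod m) = 0" if "k < m" for k
    proof (cases "Suc k = m")
      case True
      then have "p (Suc k mod m) = p (Suc k)" using \<open>p m = 1\<close> by (simp add: p_def)
      then show ?thesis using p_Suc[of k] by simp
    next
      case False
      then show ?thesis using that p_Suc[of k] by simp
    qed
    moreover have "p 0 \<noteq> 0" by (simp add: p_def)
    ultimately show "\<exists>v. (\<exists>k < m. v k \<noteq> 0) \<and> (\<forall>k < m. d (c ! k) * v k + v (Suc k mod m) = 0)"
      using m by blast
  next
    assume "\<exists>v. (\<exists>k < m. v k \<noteq> 0) \<and> (\<forall>k < m. d (c ! k) * v k + v (Suc k mod m) = 0)"
    then obtain v k where v: "k < m" "v k \<noteq> 0"
      "\<And>k. k < m \<Longrightarrow> d (c ! k) * v k + v (Suc k mod m) = 0" by blast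
    have step: "v (Suc k mod m) = - d (c ! k) * v k" if "k < m" for k
      using v(3)[OF that] by (simp add: eq_neg_iff_add_eq_0 add.commute)
    have vk: "v (k mod m) = p k * v 0" if "k \<le> m" for k
      using that
    proof (induction k)
      case 0
      then show ?case by (simp add: p_def)
    next
      case (Suc k)
      then show ?case using step[of k] p_Suc[of k] by simp
    qed
    have "v 0 \<noteq> 0" using vk[of k] v(1,2) by auto
    then show "p m = 1" using vk[of m] by simp
  qed
  ultimately show ?thesis by (simp add: m_def)
qed

section \<open>The blocks of a permutation\<close>

lemma diag_plus_permutation_carrier [simp]:
  "mat_diag N d + permutation_mat N \<sigma> \<in> carrier_mat N N"
  by (auto simp: permutation_mat_def mat_diag_def)

lemma diag_plus_permutation_index:
  assumes "i < N" "j < N"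
  shows "(mat_diag N d + permutation_mat N \<sigma>) $$ (i, j) =
    (if j = i then d i else 0) + (if j = \<sigma> i then 1 else 0)"
  using assms by (auto simp: permutation_mat_def mat_diag_def)

lemma start_in_support:
  assumes "permutation \<sigma>"
  shows "x \<in> set (support \<sigma> x)"
  using least_power_of_permutation(2)[OF assms] by force

lemma set_support_subset:
  assumes "\<sigma> permutes S" "x \<in> S"
  shows "set (support \<sigma> x) \<subseteq> S"
  using permutes_in_image[OF permutes_funpow[OF assms(1)]] assms(2) by auto

lemma apply_mem_support_iff:
  assumes "permutation \<sigma>"
  shows "\<sigma> y \<in> set (support \<sigma> x) \<longleftrightarrow> y \<in> set (support \<sigma> x)"
proof -
  have "(\<sigma> ^^ 1) y \<in> set (support \<sigma> y)"
    unfolding support_set[OF assms] by blast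
  then have "set (support \<sigma> (\<sigma> y)) \<inter> set (support \<sigma> y) \<noteq> {}"
    using start_in_support[OF assms, of "\<sigma> y"] by auto
  then have "set (support \<sigma> (\<sigma> y)) = set (support \<sigma> y)"
    using disjoint_support[OF assms] by (meson UNIV_I disjoint_def image_iff)
  then show ?thesis
    using disjoint_support'[OF assms, of y x] disjoint_support'[OF assms, of "\<sigma> y" x] by simp
qed

lemma apply_support_nth:
  assumes "permutation \<sigma>" "k < length (support \<sigma> x)"
  shows "\<sigma> (support \<sigma> x ! k) = support \<sigma> x ! (Suc k mod length (support \<sigma> x))"
proof (cases "Suc k = least_power \<sigma> x")
  case True
  then have "\<sigma> ((\<sigma> ^^ k) x) = x"
    using least_power_of_permutation(1)[OF assms(1), of x] by (metis funpow.simps(2) o_apply)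
  then show ?thesis using True assms(2) by simp
next
  case False
  then show ?thesis using assms(2) by simp
qed

lemma reduced_by_support:
  assumes "permutation \<sigma>"
  shows "reduced_by (mat_diag N d + permutation_mat N \<sigma>) (support \<sigma> x)"
  unfolding reduced_by_def
proof (intro allI impI)
  fix i j
  let ?A = "mat_diag N d + permutation_mat N \<sigma>"
  assume "i < dim_row ?A" "j < dim_col ?A" and nz: "?A $$ (i, j) \<noteq> 0"
  then have "i < N" "j < N" by (auto simp: permutation_mat_def)
  with nz have "j = i \<or> j = \<sigma> i"
    by (auto simp: diag_plus_permutation_index split: if_splits)
  then show "i \<in> set (support \<sigma> x) \<longleftrightarrow> j \<in> set (support \<sigma> x)"
    using apply_mem_support_iff[OF assms] by blast
qed

lemma block_of_support:
  assumes "\<sigma> permutes {0..<N}" "x < N"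
  shows "block_of (mat_diag N d + permutation_mat N \<sigma>) (support \<sigma> x) =
    cycle_block d (support \<sigma> x)"
proof -
  have perm: "permutation \<sigma>"
    using assms(1) unfolding permutation_permutes by blast
  define c where "c = support \<sigma> x"
  have dist: "distinct c"
    unfolding c_def by (rule cycle_of_permutation[OF perm])
  have sub: "set c \<subseteq> {0..<N}"
    unfolding c_def by (rule set_support_subset[OF assms(1)]) (simp add: assms(2))
  have next_pos: "\<sigma> (c ! k) = c ! (Suc k mod length c)" if "k < length c" for k
    using apply_support_nth[OF perm] that unfolding c_def by blast
  have "block_of (mat_diag N d + permutation_mat N \<sigma>) c = cycle_block d c"
  proof (rule eq_matI)
    fix k l assume "k < dim_row (cycle_block d c)" "l < dim_col (cycle_block d c)"
    then have kl: "k < length c" "l < length c" by (metis cycle_block_carrier carrier_matD)+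
    then have lt: "c ! k < N" "c ! l < N" using sub nth_mem by fastforce+
    have "Suc k mod length c < length c" using kl by (intro mod_less_divisor) auto
    then have "c ! l = \<sigma> (c ! k) \<longleftrightarrow> l = Suc k mod length c"
      unfolding next_pos[OF kl(1)] using nth_eq_iff_index_eq[OF dist kl(2)] by blast
    moreover have "c ! l = c ! k \<longleftrightarrow> l = k"
      using nth_eq_iff_index_eq[OF dist kl(2,1)] .
    ultimately show "block_of (mat_diag N d + permutation_mat N \<sigma>) c $$ (k, l) =
        cycle_block d c $$ (k, l)"
      using kl by (simp add: block_of_def cycle_block_index diag_plus_permutation_index[OF lt])
  qed (simp_all add: block_of_def carrier_matD[OF cycle_block_carrier])
  then show ?thesis unfolding c_def .
qed

text \<open>Every index lies in the cycle through itself, and the chosen starting elements represent all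
  cycles.\<close>

lemma cycle_starts_cover:
  assumes "\<sigma> permutes {0..<N}" "cycle_starts N \<sigma> n"
  shows "(\<Union>i < num_cycles N \<sigma>. set (support \<sigma> (n i))) = {..<N}"
proof -
  have perm: "permutation \<sigma>"
    using assms(1) unfolding permutation_permutes by blast
  have "(\<lambda>i. set (support \<sigma> (n i))) ` {..<num_cycles N \<sigma>} = cycle_sets N \<sigma>"
    using assms(2) unfolding cycle_starts_def bij_betw_def lessThan_atLeast0 by blast
  then have "(\<Union>i < num_cycles N \<sigma>. set (support \<sigma> (n i))) = \<Union> (cycle_sets N \<sigma>)"
    by metis
  also have "\<dots> = {0..<N}"
  proof
    show "\<Union> (cycle_sets N \<sigma>) \<subseteq> {0..<N}"
      unfolding cycle_sets_def using set_support_subset[OF assms(1)] by blast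
    show "{0..<N} \<subseteq> \<Union> (cycle_sets N \<sigma>)"
      unfolding cycle_sets_def using start_in_support[OF perm] by blast
  qed
  finally show ?thesis by (simp add: lessThan_atLeast0)
qed

theorem theorem1p1:
  fixes N :: nat and \<sigma> :: "nat \<Rightarrow> nat" and d :: "nat \<Rightarrow> complex" and n :: "nat \<Rightarrow> nat"
  defines "A \<equiv> mat_diag N d + permutation_mat N \<sigma>"
    and "K \<equiv> num_cycles N \<sigma>"
    and "C \<equiv> \<lambda>i. support \<sigma> (n i)"
  assumes "N \<ge> 1"
    and "\<sigma> permutes {0..<N}"
    and "cycle_starts N \<sigma> n"
  shows "(invertible_mat A \<longleftrightarrow> (\<forall>i<K. (\<Prod>l\<in>set (C i). d l) \<noteq> (- 1) ^ length (C i))) \<and>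
         s_min A = (MIN i\<in>{0..<K}. s_min (cycle_block d (C i)))"
proof -
  have perm: "permutation \<sigma>"
    using assms(5) unfolding permutation_permutes by blast
  have A: "A \<in> carrier_mat N N" unfolding A_def by simp
  have start: "n i < N" if "i < K" for i
    using assms(6) that unfolding cycle_starts_def K_def by (auto simp: image_subset_iff)
  have dist: "distinct (C i)" for i
    unfolding C_def by (rule cycle_of_permutation[OF perm])
  have nonempty: "C i \<noteq> []" for i
    using start_in_support[OF perm, of "n i"] unfolding C_def by force
  have red: "reduced_by A (C i)" for i
    unfolding A_def C_def by (rule reduced_by_support[OF perm])
  have block: "block_of A (C i) = cycle_block d (C i)" if "i < K" for i
    unfolding A_def C_def by (rule block_of_support[OF assms(5) start[OF that]])
  have cover: "(\<Union>c \<in> C ` {0..<K}. set c) = {..<N}"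
    using cycle_starts_cover[OF assms(5,6)] unfolding C_def K_def
    by (simp add: lessThan_atLeast0)
  have "0 \<in> (\<Union>c \<in> C ` {0..<K}. set c)" unfolding cover using \<open>N \<ge> 1\<close> by simp
  then have "0 < K" by auto

  have "eigenvalue A 0 \<longleftrightarrow> (\<exists>c \<in> C ` {0..<K}. eigenvalue (block_of A c) 0)"
    by (rule eigenvalue_iff_block[OF A _ cover]) (use dist red in auto)
  also have "\<dots> \<longleftrightarrow> (\<exists>i < K. eigenvalue (cycle_block d (C i)) 0)"
    using block by (auto simp: Bex_def)
  finally have inv: "invertible_mat A \<longleftrightarrow> (\<forall>i<K. (\<Prod>l\<in>set (C i). d l) \<noteq> (- 1) ^ length (C i))"
    unfolding invertible_mat_iff_not_eigenvalue_0[OF A]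
      eigenvalue_0_cycle_block[OF dist nonempty] by blast

  have "singular_values A = (\<Union>c \<in> C ` {0..<K}. singular_values (block_of A c))"
    by (rule singular_values_Union_blocks[OF A _ cover]) (use dist red in auto)
  also have "\<dots> = (\<Union>i \<in> {0..<K}. singular_values (cycle_block d (C i)))"
    using block by simp
  finally have "s_min A = (MIN i\<in>{0..<K}. s_min (cycle_block d (C i)))"
    unfolding s_min_def
    using \<open>0 < K\<close> finite_singular_values[OF cycle_block_carrier]
      singular_values_nonempty[OF cycle_block_carrier] nonempty
    by (simp add: Min_UN)
  with inv show ?thesis by blast
qed

end
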